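(* For all $t\in(0,\pi/2)$, $$\sqrt{\cos t}<\left(\frac{\sin t}{t}e^{t\cot t-1}\right)^{1/2}<\frac{1+\cos t}{2}<\frac{\frac{\sin t}{t}+e^{t\cot t-1}}{2}<\left(e^{-1}+\frac2\pi\right)\frac{1+\cos t}{2}.$$ *)

theory Defs
  imports Complex_Main
begin

end

theory Submission
  imports Defs "HOL-Real_Asymp.Real_Asymp"
begin

text \<open>
  Write \<open>S = sin t / t\<close> and \<open>E = exp (t * cot t - 1)\<close>. Each inequality compares a function with
  its limit at an endpoint, and each derivative factorises. Up to positive factors,
  the derivative of \<open>ln (S * E) - ln (cos t)\<close> is \<open>(t - sin t * cos t) * (sin t - t * cos t)\<close>,
  and that of \<open>2 * ln ((1 + cos t) / 2) - ln (S * E)\<close> is \<open>(t - sin t)\<^sup>2\<close>.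
  The derivative of \<open>(S + E) / (1 + cos t)\<close> is a positive multiple of \<open>(t - sin t) * (S\<^sup>2 - E)\<close>,
  so this ratio increases strictly from \<open>1\<close> at \<open>0\<close> to \<open>exp (-1) + 2 / pi\<close> at \<open>pi / 2\<close> as soon as
  \<open>E < S\<^sup>2\<close>, which follows by differentiating \<open>2 * ln S - ln E\<close>.
\<close>

text \<open>The functions below involve quotients such as \<open>sin t / t\<close>, whose HOL value
  at \<open>0\<close> is not their limit, so a limit stands in for \<open>f a\<close>. Passing to
  the limit only gives \<open>L \<le> f m\<close>; strictness comes from the further increase
  between the intermediate point \<open>m\<close> and \<open>b\<close>.\<close>

lemma tendsto_at_right_less_DERIV_pos:
  fixes f :: "real \<Rightarrow> real"
  assumes lim: "(f \<longlongrightarrow> L) (at_right a)" and "a < b"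
    and deriv: "\<And>x. a < x \<Longrightarrow> x \<le> b \<Longrightarrow> \<exists>y. (f has_real_derivative y) (at x) \<and> 0 < y"
  shows "L < f b"
proof -
  obtain m where m: "a < m" "m < b"
    using \<open>a < b\<close> dense by blast
  have incr: "f x < f y" if "a < x" "x < y" "y \<le> b" for x y
    by (rule DERIV_pos_imp_increasing) (use that deriv in auto)
  have "eventually (\<lambda>x. f x \<le> f m) (at_right a)"
    unfolding eventually_at_right_field using m incr by (intro exI[of _ m]) (auto intro: less_imp_le)
  then have "L \<le> f m"
    by (intro tendsto_upperbound[OF lim]) auto
  also have "f m < f b"
    using m incr by simp
  finally show ?thesis .
qed

lemma sin_less_self:
  fixes t :: real
  assumes "0 < t"
  shows "sin t < t"
proof -
  let ?f = "\<lambda>t::real. t - sin t"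
  \<comment> \<open>The derivative \<open>1 - cos x\<close> vanishes at multiples of
    \<open>2 * pi\<close>. Strict growth is therefore used only up to \<open>u \<le> 1\<close>, and
    weak monotonicity carries the bound on to \<open>t\<close>.\<close>
  define u where "u = min t 1"
  have u: "0 < u" "u \<le> 1" "u \<le> t"
    using assms by (auto simp: u_def)
  have "0 < ?f u"
  proof (rule tendsto_at_right_less_DERIV_pos[OF _ \<open>0 < u\<close>])
    show "(?f \<longlongrightarrow> 0) (at_right 0)"
      by real_asymp
    fix x assume "0 < x" "x \<le> u"
    then have "cos x < 1"
      using u pi_ge_two cos_monotone_0_pi[of 0 x] by simp
    then show "\<exists>y. (?f has_real_derivative y) (at x) \<and> 0 < y"
      by (intro exI[of _ "1 - cos x"]) (auto intro!: derivative_eq_intros)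
  qed
  moreover have "?f u \<le> ?f t"
    by (rule DERIV_nonneg_imp_nondecreasing[OF \<open>u \<le> t\<close>])
      (auto intro!: exI derivative_eq_intros)
  ultimately show ?thesis by simp
qed

lemma mult_cos_less_sin:
  fixes t :: real
  assumes "0 < t" "t < pi"
  shows "t * cos t < sin t"
proof -
  let ?f = "\<lambda>t::real. sin t - t * cos t"
  have "0 < ?f t"
  proof (rule tendsto_at_right_less_DERIV_pos[OF _ \<open>0 < t\<close>])
    show "(?f \<longlongrightarrow> 0) (at_right 0)"
      by real_asymp
    fix x assume "0 < x" "x \<le> t"
    then show "\<exists>y. (?f has_real_derivative y) (at x) \<and> 0 < y"
      using assms by (intro exI[of _ "x * sin x"]) (auto intro!: derivative_eq_intros mult_pos_pos sin_gt_zero)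
  qed
  then show ?thesis by simp
qed

text \<open>Together with \<open>algebra_simps\<close>, these two rules rewrite every polynomial in \<open>sin x\<close> and \<open>cos x\<close>
  to a normal form of degree at most 1 in \<open>sin x\<close>.\<close>

lemma sin_mult_self: "sin x * sin x = 1 - cos x * cos x" for x :: real
  using sin_cos_squared_add[of x] by (simp add: power2_eq_square)

lemma sin_mult_left_self: "sin x * (sin x * a) = a - cos x * (cos x * a)" for x a :: real
  by (simp only: mult.assoc[symmetric] sin_mult_self left_diff_distrib mult_1_left)

text \<open>The Cusa inequality \<open>3 * sin x < x * (2 + cos x)\<close> at \<open>x = 2 * t\<close>.\<close>

lemma Cusa_double_angle:
  fixes t :: real
  assumes "0 < t" "t < pi"
  shows "3 * sin t * cos t < t * (1 + 2 * (cos t)\<^sup>2)"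
proof -
  let ?f = "\<lambda>t::real. t * (1 + 2 * (cos t)\<^sup>2) - 3 * sin t * cos t"
  have "0 < ?f t"
  proof (rule tendsto_at_right_less_DERIV_pos[OF _ \<open>0 < t\<close>])
    show "(?f \<longlongrightarrow> 0) (at_right 0)"
      by real_asymp
    fix x assume x: "0 < x" "x \<le> t"
    have "0 < sin x" "x * cos x < sin x"
      using x assms by (auto intro: sin_gt_zero mult_cos_less_sin)
    moreover have "(?f has_real_derivative 4 * sin x * (sin x - x * cos x)) (at x)"
      apply (rule derivative_eq_intros refl)+
      apply simp
      by (simp add: power2_eq_square sin_mult_self sin_mult_left_self algebra_simps)
    ultimately show "\<exists>y. (?f has_real_derivative y) (at x) \<and> 0 < y"
      by (intro exI) auto
  qed
  then show ?thesis by simp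
qed

text \<open>The derivative of the difference is exactly the gap in \<open>Cusa_double_angle\<close>.
  The difference itself is the numerator in the derivative of
  \<open>2 * ln S - ln E\<close>.\<close>

lemma two_sin_squared_less:
  fixes t :: real
  assumes "0 < t" "t < pi"
  shows "2 * (sin t)\<^sup>2 < t * sin t * cos t + t\<^sup>2"
proof -
  let ?f = "\<lambda>t::real. t * sin t * cos t + t\<^sup>2 - 2 * (sin t)\<^sup>2"
  have "0 < ?f t"
  proof (rule tendsto_at_right_less_DERIV_pos[OF _ \<open>0 < t\<close>])
    show "(?f \<longlongrightarrow> 0) (at_right 0)"
      by real_asymp
    fix x assume x: "0 < x" "x \<le> t"
    have "3 * sin x * cos x < x * (1 + 2 * (cos x)\<^sup>2)"
      using x assms by (intro Cusa_double_angle) auto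
    moreover have "(?f has_real_derivative x * (1 + 2 * (cos x)\<^sup>2) - 3 * sin x * cos x) (at x)"
      apply (rule derivative_eq_intros refl)+
      apply simp
      by (simp add: power2_eq_square sin_mult_self sin_mult_left_self algebra_simps)
    ultimately show "\<exists>y. (?f has_real_derivative y) (at x) \<and> 0 < y"
      by (intro exI) auto
  qed
  then show ?thesis by simp
qed

lemma exp_cot_less_sinc_squared:
  fixes t :: real
  assumes "0 < t" "t < pi"
  shows "exp (t * cot t - 1) < (sin t / t)\<^sup>2"
proof -
  \<comment> \<open>Taking logarithms removes the exponential, so the derivative is rational in
    \<open>x\<close>, \<open>sin x\<close> and \<open>cos x\<close>.\<close>
  let ?f = "\<lambda>t::real. 2 * ln (sin t / t) - (t * cos t / sin t - 1)"
  have pos: "0 < sin x" if "0 < x" "x \<le> t" for x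
    using that assms by (intro sin_gt_zero) auto
  have "0 < ?f t"
  proof (rule tendsto_at_right_less_DERIV_pos[OF _ \<open>0 < t\<close>])
    show "(?f \<longlongrightarrow> 0) (at_right 0)"
      by real_asymp
    fix x assume x: "0 < x" "x \<le> t"
    let ?D = "(x * sin x * cos x + x\<^sup>2 - 2 * (sin x)\<^sup>2) / (x * (sin x)\<^sup>2)"
    have "2 * (sin x)\<^sup>2 < x * sin x * cos x + x\<^sup>2"
      using x assms by (intro two_sin_squared_less) auto
    then have "0 < ?D"
      using x pos[OF x] by simp
    moreover have "(?f has_real_derivative ?D) (at x)"
      apply (insert x pos[OF x])
      apply (rule derivative_eq_intros refl | (simp; fail))+
      apply (simp add: divide_simps)
      by (simp add: power2_eq_square sin_mult_self sin_mult_left_self algebra_simps)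
    ultimately show "\<exists>y. (?f has_real_derivative y) (at x) \<and> 0 < y"
      by blast
  qed
  then have "t * cot t - 1 < 2 * ln (sin t / t)"
    by (simp add: cot_def)
  also have "\<dots> = ln ((sin t / t)\<^sup>2)"
    using assms pos[of t] by (subst ln_realpow) auto
  finally show ?thesis
    using assms pos[of t] by (subst (asm) ln_exp[symmetric], subst (asm) ln_less_cancel_iff) auto
qed

text \<open>This is the first inequality of the chain, squared. The bound \<open>pi / 2\<close>
  keeps \<open>ln (cos t)\<close> meaningful.\<close>

lemma cos_less_sinc_mult_exp_cot:
  fixes t :: real
  assumes "0 < t" "t < pi / 2"
  shows "cos t < sin t / t * exp (t * cot t - 1)"
proof -
  let ?f = "\<lambda>t::real. ln (sin t / t) + (t * cos t / sin t - 1) - ln (cos t)"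
  have pos: "0 < sin x" "0 < cos x" if "0 < x" "x \<le> t" for x
    using that assms by (auto intro!: sin_gt_zero cos_gt_zero_pi)
  have "0 < ?f t"
  proof (rule tendsto_at_right_less_DERIV_pos[OF _ \<open>0 < t\<close>])
    show "(?f \<longlongrightarrow> 0) (at_right 0)"
      by real_asymp
    fix x assume x: "0 < x" "x \<le> t"
    let ?D = "(x - sin x * cos x) * (sin x - x * cos x) / (x * (sin x)\<^sup>2 * cos x)"
    have "sin x * cos x \<le> sin x"
      using pos[OF x] by (simp add: mult_le_cancel_left1)
    also have "\<dots> < x"
      using x by (intro sin_less_self)
    finally have "0 < ?D"
      using x assms pos[OF x] mult_cos_less_sin[of x] by simp
    moreover have "(?f has_real_derivative ?D) (at x)"
      apply (insert x pos[OF x])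
      apply (rule derivative_eq_intros refl | (simp; fail))+
      apply (simp add: divide_simps)
      by (simp add: power2_eq_square sin_mult_self sin_mult_left_self algebra_simps)
    ultimately show "\<exists>y. (?f has_real_derivative y) (at x) \<and> 0 < y"
      by blast
  qed
  then have "ln (cos t) < ln (sin t / t * exp (t * cot t - 1))"
    using assms pos[of t] by (subst ln_mult_pos) (auto simp: cot_def)
  then show ?thesis
    using assms pos[of t] by (subst (asm) ln_less_cancel_iff) auto
qed

text \<open>This is the second inequality, squared. The numerator of the derivative is a perfect
  square, nonzero because \<open>sin x < x\<close>.\<close>

lemma sinc_mult_exp_cot_less:
  fixes t :: real
  assumes "0 < t" "t < pi"
  shows "sin t / t * exp (t * cot t - 1) < ((1 + cos t) / 2)\<^sup>2"
proof -
  let ?f = "\<lambda>t::real. 2 * ln ((1 + cos t) / 2) - (ln (sin t / t) + (t * cos t / sin t - 1))"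
  have pos: "0 < sin x" "0 < 1 + cos x" if "0 < x" "x \<le> t" for x
    using that assms cos_monotone_0_pi[of x pi] by (auto intro!: sin_gt_zero)
  have "0 < ?f t"
  proof (rule tendsto_at_right_less_DERIV_pos[OF _ \<open>0 < t\<close>])
    show "(?f \<longlongrightarrow> 0) (at_right 0)"
      by real_asymp
    fix x assume x: "0 < x" "x \<le> t"
    let ?D = "(x - sin x)\<^sup>2 / (x * (sin x)\<^sup>2)"
    have "0 < ?D"
      using x pos[OF x] sin_less_self[of x] by simp
    moreover have "(?f has_real_derivative ?D) (at x)"
      apply (insert x pos[OF x])
      apply (rule derivative_eq_intros refl | (simp; fail))+
      apply (simp add: divide_simps)
      by (simp add: power2_eq_square sin_mult_self sin_mult_left_self algebra_simps)
    ultimately show "\<exists>y. (?f has_real_derivative y) (at x) \<and> 0 < y"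
      by blast
  qed
  then have "ln (sin t / t * exp (t * cot t - 1)) < 2 * ln ((1 + cos t) / 2)"
    using assms pos[of t] by (subst ln_mult_pos) (auto simp: cot_def)
  also have "\<dots> = ln (((1 + cos t) / 2)\<^sup>2)"
    using assms pos[of t] by (subst ln_realpow) auto
  finally show ?thesis
    using assms pos[of t] by (subst (asm) ln_less_cancel_iff) auto
qed

lemma DERIV_sinc_plus_exp_cot_ratio:
  fixes x :: real
  assumes "0 < x" "x < pi"
  shows "((\<lambda>t. (sin t / t + exp (t * cot t - 1)) / (1 + cos t)) has_real_derivative
           (x - sin x) * ((sin x / x)\<^sup>2 - exp (x * cot x - 1)) / ((sin x)\<^sup>2 * (1 + cos x))) (at x)"
proof -
  have pos: "0 < sin x" "0 < 1 + cos x"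
    using assms cos_monotone_0_pi[of x pi] by (auto intro!: sin_gt_zero)
  define E s c where "E = exp (x * cot x - 1)" and "s = sin x" and "c = cos x"
  define d where "d = 1 + c"
  have nz: "x \<noteq> 0" "s \<noteq> 0" "d \<noteq> 0"
    using assms pos by (simp_all add: s_def c_def d_def)
  have sinc: "((\<lambda>t. sin t / t) has_real_derivative (x * c - s) / x\<^sup>2) (at x)"
    using nz by (auto intro!: derivative_eq_intros simp: s_def c_def power2_eq_square)
  have exp_cot: "((\<lambda>t. exp (t * cot t - 1)) has_real_derivative E * ((c * s - x) / s\<^sup>2)) (at x)"
    using nz unfolding E_def
    by (auto intro!: derivative_eq_intros simp: s_def c_def cot_def field_simps power2_eq_square
        sin_mult_self sin_mult_left_self)
  \<comment> \<open>The quotient rule leaves \<open>d\<^sup>2\<close> in the denominator. This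
    factorisation exposes one factor \<open>d\<close> in the whole numerator, where the terms in
    \<open>c\<close> then cancel.\<close>
  have "s\<^sup>2 = (1 - c) * d"
    unfolding s_def d_def c_def by (simp add: power2_eq_square sin_mult_self algebra_simps)
  then have cube: "s * s\<^sup>2 = s * (1 - c) * d"
    by simp
  have numerator: "((x * c - s) * s\<^sup>2 + E * (c * s - x) * x\<^sup>2) * d + (x * s + E * x\<^sup>2) * (s * s\<^sup>2)
      = (x - s) * (s\<^sup>2 - E * x\<^sup>2) * d"
    unfolding cube by (simp add: power2_eq_square algebra_simps)
  have "(((x * c - s) / x\<^sup>2 + E * ((c * s - x) / s\<^sup>2)) * d - (s / x + E) * - s) / (d * d)
      = (((x * c - s) * s\<^sup>2 + E * (c * s - x) * x\<^sup>2) * d + (x * s + E * x\<^sup>2) * (s * s\<^sup>2))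
        / (x\<^sup>2 * s\<^sup>2 * d\<^sup>2)"
    using nz by (simp add: field_simps power2_eq_square)
  also have "\<dots> = (x - s) * ((s / x)\<^sup>2 - E) / (s\<^sup>2 * d)"
    unfolding numerator using nz by (simp add: field_simps power2_eq_square)
  finally have quotient: "(((x * c - s) / x\<^sup>2 + E * ((c * s - x) / s\<^sup>2)) * d - (s / x + E) * - s) / (d * d)
      = (x - s) * ((s / x)\<^sup>2 - E) / (s\<^sup>2 * d)" .
  have "((\<lambda>t. 1 + cos t) has_real_derivative - s) (at x)"
    by (auto intro!: derivative_eq_intros simp: s_def)
  from DERIV_divide[OF DERIV_add[OF sinc exp_cot] this] nz quotient show ?thesis
    by (simp add: E_def d_def flip: s_def c_def)
qed

theorem corollary5:
  fixes t :: real
  assumes "t \<in> {0<..<pi/2}"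
  shows "sqrt (cos t) < (sin t / t * exp (t * cot t - 1)) powr (1/2)
    \<and> (sin t / t * exp (t * cot t - 1)) powr (1/2) < (1 + cos t) / 2
    \<and> (1 + cos t) / 2 < (sin t / t + exp (t * cot t - 1)) / 2
    \<and> (sin t / t + exp (t * cot t - 1)) / 2 < (exp (-1) + 2 / pi) * ((1 + cos t) / 2)"
proof -
  have t: "0 < t" "t < pi / 2"
    using assms by auto
  then have pos: "0 < sin t" "0 < cos t"
    by (auto intro!: sin_gt_zero cos_gt_zero_pi)
  let ?P = "sin t / t * exp (t * cot t - 1)"
  let ?R = "\<lambda>t::real. (sin t / t + exp (t * cot t - 1)) / (1 + cos t)"
  have powr_half: "?P powr (1/2) = sqrt ?P"
    using t pos by (intro powr_half_sqrt) auto
  have lower: "sqrt (cos t) < sqrt ?P"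
    using cos_less_sinc_mult_exp_cot[OF t] by simp
  have "sqrt ?P < sqrt (((1 + cos t) / 2)\<^sup>2)"
    using t by (intro real_sqrt_less_mono sinc_mult_exp_cot_less) auto
  then have upper: "sqrt ?P < (1 + cos t) / 2"
    using pos by simp
  \<comment> \<open>The endpoint \<open>pi / 2\<close> is included because the upper bound is the
    value of \<open>?R\<close> there, whereas the lower bound is the limit at
    \<open>0\<close>.\<close>
  have deriv: "\<exists>y. (?R has_real_derivative y) (at x) \<and> 0 < y" if x: "0 < x" "x \<le> pi / 2" for x
  proof (intro exI conjI)
    have "x < pi"
      using x pi_gt_zero by linarith
    then show "(?R has_real_derivative
        (x - sin x) * ((sin x / x)\<^sup>2 - exp (x * cot x - 1)) / ((sin x)\<^sup>2 * (1 + cos x))) (at x)"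
      by (intro DERIV_sinc_plus_exp_cot_ratio x)
    have "0 < sin x" "0 \<le> cos x"
      using x \<open>x < pi\<close> by (auto intro!: sin_gt_zero cos_ge_zero)
    then show "0 < (x - sin x) * ((sin x / x)\<^sup>2 - exp (x * cot x - 1)) / ((sin x)\<^sup>2 * (1 + cos x))"
      using exp_cot_less_sinc_squared[OF x(1) \<open>x < pi\<close>] sin_less_self[OF x(1)] by auto
  qed
  have "1 < ?R t"
  proof (rule tendsto_at_right_less_DERIV_pos[OF _ t(1)])
    show "(?R \<longlongrightarrow> 1) (at_right 0)"
      unfolding cot_def by real_asymp
  qed (use t in \<open>intro deriv; linarith\<close>)
  then have ratio_gt: "1 + cos t < sin t / t + exp (t * cot t - 1)"
    using pos by (simp add: less_divide_eq)
  have "?R t < ?R (pi / 2)"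
    using t(1) by (intro DERIV_pos_imp_increasing[OF t(2)] deriv) linarith+
  also have "?R (pi / 2) = exp (-1) + 2 / pi"
    by (simp add: cot_def)
  finally have "sin t / t + exp (t * cot t - 1) < (exp (-1) + 2 / pi) * (1 + cos t)"
    using pos by (simp add: divide_less_eq)
  then have "(sin t / t + exp (t * cot t - 1)) / 2 < (exp (-1) + 2 / pi) * (1 + cos t) / 2"
    by (rule divide_strict_right_mono) simp
  moreover have "(1 + cos t) / 2 < (sin t / t + exp (t * cot t - 1)) / 2"
    using ratio_gt by (rule divide_strict_right_mono) simp
  ultimately show ?thesis
    using lower upper unfolding powr_half times_divide_eq_right by blast
qed

end
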